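(* Let $K\ge2$, $h_K=\sum_{k=1}^K\frac1k$, and let $$f(p)=\frac{K\,\mathbf 1\{h_Kp\le1\}}{\lceil Kh_Kp\rceil}\quad\text{for }p>0,\qquad f(0)=\infty .$$ Define, for $\mathbf p\in[0,1]^K$ and with $\inf\varnothing=1$, $$F_{\mathrm{EHom}}(\mathbf p)=\inf\left\{\alpha\in(0,1):\ \bigvee_{\ell\le K}\left(\frac1\ell\sum_{i=1}^\ell f\left(\frac{p_i}{\alpha}\right)\right)\ge1\right\},$$ $$F_{\mathrm{Hom}}(\mathbf p)=\inf\left\{\alpha\in(0,1):\ \frac1K\sum_{k=1}^K f\left(\frac{p_k}{\alpha}\right)\ge1\right\}.$$ Then $F_{\mathrm{EHom}}$ is an ex-p-merging function and it strictly dominates $F_{\mathrm{Hom}}$.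
   Context: $\bigvee$ denotes maximum. Fix an atomless probability space; $\mathcal U^K$ is the set of all $K$-dimensional random vectors (arbitrary joint distribution) with components uniform on $[0,1]$; a vector is exchangeable if its law is invariant under permutations of components. An ex-p-merging function is an increasing (non-decreasing in each component) Borel function $F:[0,1]^K\to[0,1]$ with $\mathbb P(F(\mathbf P)\le\alpha)\le\alpha$ for all $\alpha\in(0,1)$ and all exchangeable $\mathbf P\in\mathcal U^K$. $F$ strictly dominates $G$ if $F(\mathbf p)\le G(\mathbf p)$ for all $\mathbf p\in[0,1]^K$ and $F(\mathbf p)<G(\mathbf p)$ for at least one $\mathbf p$. *)

theory Defs
  imports "HOL-Probability.Probability"
begin

definition atomless :: "'a measure \<Rightarrow> bool" where
  "atomless M \<longleftrightarrow>
     (\<forall>A\<in>sets M. emeasure M A > 0 \<longrightarrow>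
        (\<exists>B\<in>sets M. B \<subseteq> A \<and> 0 < emeasure M B \<and> emeasure M B < emeasure M A))"

text \<open>
  A point of \<open>[0,1]^K\<close> is an extensional function on the index set \<open>{1..K}\<close>; this measurable
  space is \<open>[0,1]^K\<close> with its Borel sigma-algebra, its underlying set being \<open>space (cube K)\<close>.
\<close>

definition cube :: "nat \<Rightarrow> (nat \<Rightarrow> real) measure" where
  "cube K = (\<Pi>\<^sub>M i\<in>{1..K}. restrict_space borel {0..1})"

lemma space_cube: "space (cube K) = {1..K} \<rightarrow>\<^sub>E {0..1}"
  by (simp add: cube_def space_PiM space_restrict_space)

text \<open>
  The random vectors take values in \<open>[0,1]^K\<close> everywhere, so that \<open>F (P \<omega>)\<close> is meaningful for
  functions \<open>F\<close> on \<open>[0,1]^K\<close>.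
\<close>

definition uniform_vectors :: "'a measure \<Rightarrow> nat \<Rightarrow> ('a \<Rightarrow> nat \<Rightarrow> real) set" where
  "uniform_vectors M K =
     {P \<in> M \<rightarrow>\<^sub>M cube K.
        \<forall>i\<in>{1..K}. distr M borel (\<lambda>\<omega>. P \<omega> i) = uniform_measure lborel {0..1}}"

definition exchangeable :: "'a measure \<Rightarrow> nat \<Rightarrow> ('a \<Rightarrow> nat \<Rightarrow> real) \<Rightarrow> bool" where
  "exchangeable M K P \<longleftrightarrow>
     (\<forall>\<pi>. \<pi> permutes {1..K} \<longrightarrow>
        distr M (cube K) (\<lambda>\<omega>. \<lambda>i\<in>{1..K}. P \<omega> (\<pi> i)) = distr M (cube K) P)"

definition ex_p_merging :: "'a measure \<Rightarrow> nat \<Rightarrow> ((nat \<Rightarrow> real) \<Rightarrow> real) \<Rightarrow> bool" where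
  "ex_p_merging M K F \<longleftrightarrow>
     F \<in> borel_measurable (cube K) \<and>
     F \<in> space (cube K) \<rightarrow> {0..1} \<and>
     (\<forall>p\<in>space (cube K). \<forall>q\<in>space (cube K). (\<forall>i\<in>{1..K}. p i \<le> q i) \<longrightarrow> F p \<le> F q) \<and>
     (\<forall>P\<in>uniform_vectors M K. exchangeable M K P \<longrightarrow>
        (\<forall>\<alpha>\<in>{0<..<1}. measure M {\<omega>\<in>space M. F (P \<omega>) \<le> \<alpha>} \<le> \<alpha>))"

definition strictly_dominates ::
  "nat \<Rightarrow> ((nat \<Rightarrow> real) \<Rightarrow> real) \<Rightarrow> ((nat \<Rightarrow> real) \<Rightarrow> real) \<Rightarrow> bool" where
  "strictly_dominates K F G \<longleftrightarrow>
     (\<forall>p\<in>space (cube K). F p \<le> G p) \<and> (\<exists>p\<in>space (cube K). F p < G p)"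

text \<open>Only arguments \<open>p \<ge> 0\<close> are relevant; negative ones are lumped with \<open>p = 0\<close>.\<close>

definition hom_f :: "nat \<Rightarrow> real \<Rightarrow> ennreal" where
  "hom_f K p =
     (if p > 0
      then ennreal (real K * indicator {q. harm K * q \<le> 1} p
                      / real_of_int \<lceil>real K * harm K * p\<rceil>)
      else \<infinity>)"

definition inf1 :: "real set \<Rightarrow> real" where
  "inf1 A = (if A = {} then 1 else Inf A)"

definition F_EHom :: "nat \<Rightarrow> (nat \<Rightarrow> real) \<Rightarrow> real" where
  "F_EHom K p =
     inf1 {\<alpha>\<in>{0<..<1}.
       (MAX l\<in>{1..K}. (1 / of_nat l) * (\<Sum>i=1..l. hom_f K (p i / \<alpha>))) \<ge> 1}"

definition F_Hom :: "nat \<Rightarrow> (nat \<Rightarrow> real) \<Rightarrow> real" where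
  "F_Hom K p =
     inf1 {\<alpha>\<in>{0<..<1}. (1 / of_nat K) * (\<Sum>k=1..K. hom_f K (p k / \<alpha>)) \<ge> 1}"

end

(* The core is Markov's inequality for exchangeable sequences: among the running averages
   A_1, ..., A_K of an exchangeable nonnegative sequence X_1, ..., X_K let T be the last index with
   A_T >= 1. The event T = l is symmetric in X_1, ..., X_l, so E[X_1; T = l] = E[A_l; T = l]
   >= P(T = l), and summing over l gives P(max A_l >= 1) <= E X_1. For X_i = f(P_i / \<beta>) the right
   side is at most \<beta>, since f integrates to 1 over the half line (it takes the value K / j on an
   interval of length 1 / (K h_K) for j = 1, ..., K). Letting \<beta> decrease to \<alpha> gives validity of
   F_EHom. Domination is strict at the point (1/(K h_K), 1, ..., 1). *)
theory Submission imports Defs begin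

section \<open>Markov's inequality for the running averages of an exchangeable vector\<close>

lemma exchangeable_markov:
  fixes N :: "(nat \<Rightarrow> 'b) measure" and f :: "'b \<Rightarrow> ennreal"
  assumes sets_N: "sets N = sets (\<Pi>\<^sub>M i\<in>{1..K}. S)"
    and invariant: "\<And>\<pi>. \<pi> permutes {1..K} \<Longrightarrow> distr N N (\<lambda>x. \<lambda>i\<in>{1..K}. x (\<pi> i)) = N"
    and f[measurable]: "f \<in> borel_measurable S"
  shows "emeasure N {x\<in>space N. \<exists>l\<in>{1..K}. 1 \<le> (1 / of_nat l) * (\<Sum>i=1..l. f (x i))}
           \<le> (\<integral>\<^sup>+x. f (x 1) \<partial>N)"
proof -
  note [measurable_cong] = sets_N
  define A where "A l x = (1 / of_nat l) * (\<Sum>i=1..l. f (x i))" for l and x :: "nat \<Rightarrow> 'b"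
  \<comment> \<open>The last crossing index, not the first, is what preserves symmetry: membership
    in \<open>E l\<close> is decided by the averages \<open>A j\<close> with
    \<open>j \<ge> l\<close>, each symmetric in the first \<open>l\<close> coordinates, whereas a
    first crossing would involve shorter averages.\<close>
  define E where "E l = {x\<in>space N. 1 \<le> A l x \<and> (\<forall>j\<in>{l<..K}. A j x < 1)}" for l
  have f_comp: "(\<lambda>x. f (x i)) \<in> borel_measurable N" if "i \<in> {1..K}" for i
    using that by measurable
  have A_meas: "A l \<in> borel_measurable N" if "l \<in> {1..K}" for l
    unfolding A_def using that by (auto intro!: borel_measurable_times borel_measurable_sum f_comp)
  have E_meas: "E l \<in> sets N" if "l \<in> {1..K}" for l
  proof -
    have [measurable]: "A l \<in> borel_measurable N" "\<And>j. j \<in> {l<..K} \<Longrightarrow> A j \<in> borel_measurable N"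
      using A_meas that by auto
    show ?thesis unfolding E_def
      by measurable
  qed
  have swap: "(\<integral>\<^sup>+x. f (x i) * indicator (E l) x \<partial>N) = (\<integral>\<^sup>+x. f (x 1) * indicator (E l) x \<partial>N)"
    if l: "l \<in> {1..K}" and i: "i \<in> {1..l}" for l i
  proof -
    \<comment> \<open>Exchanging 1 and \<open>i\<close> maps \<open>{1..j}\<close> to itself for
      every \<open>j \<ge> i\<close>. Since \<open>i \<le> l\<close>, all averages that decide
      membership in \<open>E l\<close> are unchanged, while \<open>f (x 1)\<close> becomes
      \<open>f (x i)\<close>.\<close>
    define \<pi> where "\<pi> = Transposition.transpose 1 i"
    define T where "T x = (\<lambda>k\<in>{1..K}. x (\<pi> k))" for x :: "nat \<Rightarrow> 'b"
    have perm: "\<pi> permutes {1..j}" if "i \<le> j" for j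
      unfolding \<pi>_def using that i by (intro permutes_swap_id) auto
    have permK: "\<pi> permutes {1..K}" using perm l i by auto
    have T_meas: "T \<in> N \<rightarrow>\<^sub>M N"
    proof -
      have "T \<in> N \<rightarrow>\<^sub>M (\<Pi>\<^sub>M i\<in>{1..K}. S)"
        unfolding T_def
      proof (rule measurable_restrict)
        fix k assume "k \<in> {1..K}"
        then have "\<pi> k \<in> {1..K}" using permK permutes_in_image by metis
        then show "(\<lambda>x. x (\<pi> k)) \<in> N \<rightarrow>\<^sub>M S" by measurable
      qed
      then show ?thesis using measurable_cong_sets[OF refl sets_N] by blast
    qed
    have A_T: "A j (T x) = A j x" if j: "i \<le> j" "j \<le> K" for j x
    proof -
      have "(\<Sum>k=1..j. f (T x k)) = (\<Sum>k=1..j. f (x (\<pi> k)))"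
        using j by (intro sum.cong) (auto simp: T_def)
      also have "\<dots> = (\<Sum>k=1..j. f (x k))"
        using sum.permute[OF perm[OF j(1)], of "\<lambda>k. f (x k)"] by (simp add: o_def)
      finally show ?thesis by (simp add: A_def)
    qed
    have E_T: "indicator (E l) (T x) = (indicator (E l) x :: ennreal)" if "x \<in> space N" for x
      using measurable_space[OF T_meas that] that A_T l i
      by (auto simp: E_def indicator_def)
    have T_1: "f (T x 1) = f (x i)" for x
      using l i by (auto simp: T_def \<pi>_def)
    have [measurable]: "E l \<in> sets N" "(\<lambda>x. f (x 1)) \<in> borel_measurable N"
      using E_meas f_comp l i by auto
    \<comment> \<open>By invariance \<open>N\<close> may be replaced by its image under
      \<open>T\<close>; a change of variables then moves \<open>T\<close> into the
      integrand.\<close>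
    have "(\<integral>\<^sup>+x. f (x 1) * indicator (E l) x \<partial>N)
        = (\<integral>\<^sup>+x. f (x 1) * indicator (E l) x \<partial>(distr N N T))"
      using invariant[OF permK] by (simp add: T_def[abs_def])
    also have "\<dots> = (\<integral>\<^sup>+x. f (T x 1) * indicator (E l) (T x) \<partial>N)"
      by (rule nn_integral_distr[OF T_meas]) measurable
    also have "\<dots> = (\<integral>\<^sup>+x. f (x i) * indicator (E l) x \<partial>N)"
      by (intro nn_integral_cong) (simp only: T_1 E_T)
    finally show ?thesis ..
  qed
  have E_le: "emeasure N (E l) \<le> (\<integral>\<^sup>+x. f (x 1) * indicator (E l) x \<partial>N)" if l: "l \<in> {1..K}" for l
  proof -
    have [measurable]: "E l \<in> sets N" using E_meas l .
    have fi: "(\<lambda>x. f (x i) * indicator (E l) x) \<in> borel_measurable N" if "i \<in> {1..l}" for i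
      using f_comp[of i] l that by (intro borel_measurable_times_ennreal borel_measurable_indicator) auto
    have "emeasure N (E l) = (\<integral>\<^sup>+x. indicator (E l) x \<partial>N)" by simp
    also have "\<dots> \<le> (\<integral>\<^sup>+x. A l x * indicator (E l) x \<partial>N)"
      by (intro nn_integral_mono) (auto simp: E_def indicator_def)
    also have "\<dots> = (\<integral>\<^sup>+x. (1 / of_nat l) * (\<Sum>i=1..l. f (x i) * indicator (E l) x) \<partial>N)"
      by (simp add: A_def sum_distrib_right mult.assoc)
    also have "\<dots> = (1 / of_nat l) * (\<integral>\<^sup>+x. (\<Sum>i=1..l. f (x i) * indicator (E l) x) \<partial>N)"
      by (intro nn_integral_cmult borel_measurable_sum fi)
    also have "\<dots> = (1 / of_nat l) * (\<Sum>i=1..l. \<integral>\<^sup>+x. f (x i) * indicator (E l) x \<partial>N)"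
      by (simp only: nn_integral_sum[OF fi])
    \<comment> \<open>By \<open>swap\<close> all \<open>l\<close> summands are equal, so their
      number cancels against the averaging factor.\<close>
    also have "\<dots> = (1 / of_nat l) * (of_nat l * (\<integral>\<^sup>+x. f (x 1) * indicator (E l) x \<partial>N))"
      by (subst sum.cong[OF refl swap[OF l]]) simp_all
    also have "\<dots> = (\<integral>\<^sup>+x. f (x 1) * indicator (E l) x \<partial>N)"
      using l by (simp add: mult.assoc[symmetric] ennreal_divide_times
          ennreal_divide_self ennreal_of_nat_eq_real_of_nat)
    finally show ?thesis .
  qed
  have disj: "disjoint_family_on E {1..K}"
  proof -
    have "E l \<inter> E m = {}" if "l \<in> {1..K}" "m \<in> {1..K}" "l < m" for l m
      using that by (fastforce simp: E_def not_le[symmetric])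
    then show ?thesis
      unfolding disjoint_family_on_def by (metis Int_commute linorder_neqE_nat)
  qed
  have "{x\<in>space N. \<exists>l\<in>{1..K}. 1 \<le> A l x} \<subseteq> (\<Union>l\<in>{1..K}. E l)"
  proof safe
    fix x l assume x: "x \<in> space N" "l \<in> {1..K}" "1 \<le> A l x"
    define L where "L = {l\<in>{1..K}. 1 \<le> A l x}"
    have "finite L" "L \<noteq> {}" using x by (auto simp: L_def)
    then have "Max L \<in> L" and max: "\<And>j. j \<in> L \<Longrightarrow> j \<le> Max L" by auto
    then have m: "Max L \<in> {1..K}" "1 \<le> A (Max L) x" by (simp_all add: L_def)
    have "A j x < 1" if "j \<in> {Max L<..K}" for j
    proof (rule ccontr)
      assume "\<not> A j x < 1"
      then have "j \<in> L" using that m(1) by (simp add: L_def)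
      then show False using max[of j] that by simp
    qed
    then have "x \<in> E (Max L)" using m x(1) by (simp add: E_def)
    then show "x \<in> (\<Union>l\<in>{1..K}. E l)" using m(1) by blast
  qed
  then have "emeasure N {x\<in>space N. \<exists>l\<in>{1..K}. 1 \<le> A l x} \<le> emeasure N (\<Union>l\<in>{1..K}. E l)"
    using E_meas by (intro emeasure_mono) auto
  also have "\<dots> = (\<Sum>l\<in>{1..K}. emeasure N (E l))"
    using E_meas disj by (intro sum_emeasure[symmetric]) auto
  also have "\<dots> \<le> (\<Sum>l\<in>{1..K}. \<integral>\<^sup>+x. f (x 1) * indicator (E l) x \<partial>N)"
    by (intro sum_mono E_le)
  also have "\<dots> = (\<integral>\<^sup>+x. (\<Sum>l\<in>{1..K}. f (x 1) * indicator (E l) x) \<partial>N)"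
  proof (rule nn_integral_sum[symmetric])
    fix l assume l: "l \<in> {1..K}"
    then have [measurable]: "E l \<in> sets N" "(\<lambda>x. f (x 1)) \<in> borel_measurable N"
      using E_meas f_comp by auto
    show "(\<lambda>x. f (x 1) * indicator (E l) x) \<in> borel_measurable N" by measurable
  qed
  also have "\<dots> \<le> (\<integral>\<^sup>+x. f (x 1) \<partial>N)"
  proof (rule nn_integral_mono)
    fix x
    \<comment> \<open>The events are disjoint, so the indicators add up to at most 1.\<close>
    have "(\<Sum>l\<in>{1..K}. f (x 1) * indicator (E l) x) = f (x 1) * indicator (\<Union>l\<in>{1..K}. E l) x"
      using disj by (simp add: indicator_UN_disjoint sum_distrib_left)
    also have "\<dots> \<le> f (x 1)" by (simp add: indicator_def)
    finally show "(\<Sum>l\<in>{1..K}. f (x 1) * indicator (E l) x) \<le> f (x 1)" .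
  qed
  finally show ?thesis by (simp add: A_def)
qed

section \<open>The function f: monotonicity and integral\<close>

lemma antimono_hom_f:
  assumes "p \<le> q" shows "hom_f K q \<le> hom_f K p"
proof (cases "p > 0")
  case True
  show ?thesis
  proof (cases "K > 0 \<and> harm K * q \<le> 1")
    case K: True
    have h: "harm K > (0::real)" using K by (simp add: harm_pos)
    have pq: "real K * harm K * p \<le> real K * harm K * q"
      using h assms by (intro mult_left_mono) (auto simp: less_imp_le)
    have pos: "real K * harm K * p > 0" using True K h by simp
    have "\<lceil>real K * harm K * p\<rceil> > 0" using pos by linarith
    moreover have "\<lceil>real K * harm K * p\<rceil> \<le> \<lceil>real K * harm K * q\<rceil>"
      using pq by (rule ceiling_mono)
    moreover have "harm K * p \<le> 1"
      using mult_left_mono[OF assms, of "harm K"] h K by linarith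
    ultimately show ?thesis
      using True assms K by (auto simp: hom_f_def intro!: ennreal_leI divide_left_mono)
  next
    \<comment> \<open>Either \<open>K = 0\<close> or \<open>q\<close> lies beyond the support; in
      both cases \<open>hom_f K q = 0\<close>.\<close>
    case False
    then show ?thesis using True assms by (auto simp: hom_f_def)
  qed
qed (simp add: hom_f_def)

lemma measurable_hom_f[measurable]: "hom_f K \<in> borel_measurable borel"
  unfolding hom_f_def[abs_def] by measurable

text \<open>The ceiling of K h_K p is constant between consecutive multiples of 1 / (K h_K), which
  turns f into a step function that can be integrated term by term.\<close>

lemma hom_f_le_sum:
  assumes "p > 0"
  shows "hom_f K p \<le> (\<Sum>j=1..K. ennreal (real K / real j) *
           indicator {(real j - 1) / (real K * harm K)<..real j / (real K * harm K)} p)"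
proof (cases "K > 0 \<and> harm K * p \<le> 1")
  case True
  define c where "c = real K * harm K"
  have c: "c > 0" unfolding c_def using True by (simp add: harm_pos)
  define j where "j = nat \<lceil>c * p\<rceil>"
  have pos: "c * p > 0" using c assms by simp
  have jr: "real_of_int \<lceil>c * p\<rceil> = real j" using pos unfolding j_def by linarith
  have j1: "j \<ge> 1" using pos unfolding j_def by linarith
  \<comment> \<open>The cutoff h_K p \<le> 1 is what keeps the step index \<open>j\<close> at most
    \<open>K\<close>.\<close>
  have "c * p \<le> real K"
    using mult_left_mono[of "harm K * p" 1 "real K"] True by (simp add: c_def mult.assoc)
  then have jK: "j \<le> K" unfolding j_def by linarith
  have b: "c * p \<le> real j" "real j - 1 < c * p" using jr by linarith+
  have mem: "p \<in> {(real j - 1) / c<..real j / c}"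
    using b c by (simp add: field_simps)
  have "hom_f K p = ennreal (real K / real j) * indicator {(real j - 1) / c<..real j / c} p"
    using assms True mem by (simp add: hom_f_def jr flip: c_def)
  also have "\<dots> \<le> (\<Sum>j=1..K. ennreal (real K / real j) * indicator {(real j - 1) / c<..real j / c} p)"
    using j1 jK
    by (intro member_le_sum[where f = "\<lambda>j. ennreal (real K / real j) * indicator {(real j - 1) / c<..real j / c} p"]) auto
  finally show ?thesis by (simp add: c_def)
next
  case False
  then show ?thesis using assms by (auto simp: hom_f_def)
qed

text \<open>Scaling by \<beta> stretches each step to length \<beta> / (K h_K). In general only an
  inequality holds, because for large \<beta> some steps reach beyond 1 and are cut off by the
  uniform law.\<close>

lemma nn_integral_hom_f_uniform:
  assumes "\<beta> > 0"
  shows "(\<integral>\<^sup>+x. hom_f K (x / \<beta>) \<partial>(uniform_measure lborel {0..1})) \<le> ennreal \<beta>"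
proof (cases "K > 0")
  case K: True
  define c where "c = real K * harm K"
  have h: "harm K > (0::real)" using K by (simp add: harm_pos)
  have c: "c > 0" unfolding c_def using K h by simp
  have "(\<integral>\<^sup>+x. hom_f K (x / \<beta>) \<partial>(uniform_measure lborel {0..1}))
      = (\<integral>\<^sup>+x. hom_f K (x / \<beta>) * indicator {0..1} x \<partial>lborel)"
    by (subst nn_integral_uniform_measure) (auto simp: divide_ennreal_def)
  also have "\<dots> \<le> (\<integral>\<^sup>+x. (\<Sum>j=1..K. ennreal (real K / real j) *
        indicator {\<beta> * ((real j - 1) / c)<..\<beta> * (real j / c)} x) \<partial>lborel)"
  proof (rule nn_integral_mono_AE)
    \<comment> \<open>At 0 the function is infinite and the step bound fails, but a single point is
      null.\<close>
    have "AE x in lborel. x \<noteq> (0::real)" by (rule AE_lborel_singleton)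
    then show "AE x in lborel. hom_f K (x / \<beta>) * indicator {0..1} x \<le> (\<Sum>j=1..K.
        ennreal (real K / real j) * indicator {\<beta> * ((real j - 1) / c)<..\<beta> * (real j / c)} x)"
    proof eventually_elim
      case (elim x)
      show ?case
      proof (cases "x \<in> {0..1}")
        case True
        then have x: "x / \<beta> > 0" using elim assms by simp
        have ind: "indicator {\<beta> * a<..\<beta> * b} x = (indicator {a<..b} (x / \<beta>) :: ennreal)" for a b
          using assms by (simp add: indicator_def pos_less_divide_eq pos_divide_le_eq mult.commute)
        show ?thesis using hom_f_le_sum[OF x, of K, folded c_def] True
          by (simp only: ind indicator_simps(1) mult_1_right)
      qed simp
    qed
  qed
  also have "\<dots> = (\<Sum>j=1..K. ennreal (real K / real j) *
      emeasure lborel {\<beta> * ((real j - 1) / c)<..\<beta> * (real j / c)})"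
    by (subst nn_integral_sum) (auto simp: nn_integral_cmult)
  \<comment> \<open>Height times length: the factor \<open>K\<close> cancels and leaves \<beta> /
    (h_K j). Summing 1/j then yields h_K, which explains the normalization of f.\<close>
  also have "\<dots> = (\<Sum>j=1..K. ennreal (\<beta> / harm K * inverse (real j)))"
  proof (rule sum.cong[OF refl])
    fix j assume j: "j \<in> {1..K}"
    have "\<beta> * ((real j - 1) / c) \<le> \<beta> * (real j / c)"
      using assms c by (intro mult_left_mono divide_right_mono) auto
    then have "emeasure lborel {\<beta> * ((real j - 1) / c)<..\<beta> * (real j / c)} = ennreal (\<beta> / c)"
      by (simp add: diff_divide_distrib algebra_simps)
    moreover have "real K / real j * (\<beta> / c) = \<beta> / harm K * inverse (real j)"
      using K by (simp add: c_def field_simps)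
    ultimately show "ennreal (real K / real j) *
        emeasure lborel {\<beta> * ((real j - 1) / c)<..\<beta> * (real j / c)}
        = ennreal (\<beta> / harm K * inverse (real j))"
      using assms c by (simp add: ennreal_mult[symmetric])
  qed
  also have "\<dots> = ennreal (\<Sum>j=1..K. \<beta> / harm K * inverse (real j))"
    using assms h by (intro sum_ennreal) (auto simp: less_imp_le)
  also have "(\<Sum>j=1..K. \<beta> / harm K * inverse (real j)) = \<beta> / harm K * harm K"
    by (simp only: harm_def sum_distrib_left[symmetric])
  also have "\<dots> = \<beta>" by (simp add: less_imp_neq[OF h, symmetric])
  finally show ?thesis .
next
  case False
  \<comment> \<open>For \<open>K = 0\<close> the function vanishes at all positive arguments, hence
    almost everywhere on the unit interval.\<close>
  have "(\<integral>\<^sup>+x. hom_f K (x / \<beta>) \<partial>(uniform_measure lborel {0..1}))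
      = (\<integral>\<^sup>+x. hom_f K (x / \<beta>) * indicator {0..1} x \<partial>lborel)"
    by (subst nn_integral_uniform_measure) (auto simp: divide_ennreal_def)
  also have "\<dots> = (\<integral>\<^sup>+x. 0 \<partial>(lborel :: real measure))"
    using AE_lborel_singleton[of "0::real"] False assms
    by (intro nn_integral_cong_AE) (auto simp: hom_f_def indicator_def elim!: eventually_mono)
  finally show ?thesis by simp
qed

section \<open>Infima of subsets of (0,1), with value 1 for the empty set\<close>

lemma inf1_antimono:
  assumes "A \<subseteq> B" "B \<subseteq> {0<..<1}"
  shows "inf1 B \<le> inf1 A"
proof (cases "A = {}")
  case True
  \<comment> \<open>The default value 1 is consistent with monotonicity because it lies above every
    element of \<open>B\<close>.\<close>
  have "Inf B \<le> 1" if "b \<in> B" for b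
    using that assms(2) cInf_lower[of b B] bdd_belowI[of B 0] by fastforce
  then show ?thesis using True by (auto simp: inf1_def)
next
  case False
  then show ?thesis using assms bdd_belowI[of B 0]
    by (force simp: inf1_def intro!: cInf_superset_mono)
qed

lemma inf1_in_unit_interval:
  assumes "A \<subseteq> {0<..<1}"
  shows "inf1 A \<in> {0..1}"
proof -
  have "inf1 A \<le> 1" using inf1_antimono[of "{}" A] assms by (simp add: inf1_def)
  moreover have "0 \<le> inf1 A"
    using assms by (auto simp: inf1_def intro!: cInf_greatest)
  ultimately show ?thesis by simp
qed

text \<open>The bound \<open>a \<le> 1\<close> covers the empty set: its default value 1 is then not
  below \<open>a\<close>, in agreement with the absence of a witness.\<close>

lemma inf1_less_iff:
  assumes "A \<subseteq> {0<..<1}" "a \<le> 1"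
  shows "inf1 A < a \<longleftrightarrow> (\<exists>\<beta>\<in>A. \<beta> < a)"
proof (cases "A = {}")
  case False
  have "bdd_below A" using assms by (intro bdd_belowI[of _ 0]) auto
  then show ?thesis using cInf_less_iff[OF False] by (simp add: inf1_def False)
qed (use assms in \<open>simp add: inf1_def\<close>)

section \<open>The set of levels defining \<open>F_EHom\<close>, and measurability\<close>

definition E_level :: "nat \<Rightarrow> (nat \<Rightarrow> real) \<Rightarrow> real set" where
  "E_level K p = {\<alpha>\<in>{0<..<1}.
     \<exists>l\<in>{1..K}. 1 \<le> (1 / of_nat l) * (\<Sum>i=1..l. hom_f K (p i / \<alpha>))}"

text \<open>A maximum over a nonempty finite set reaches 1 exactly when some term does. The
  existential form lets each running average be treated separately.\<close>

lemma F_EHom_eq_inf1: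
  assumes "K \<ge> 1"
  shows "F_EHom K p = inf1 (E_level K p)"
proof -
  have "(MAX l\<in>{1..K}. (1 / of_nat l) * (\<Sum>i=1..l. hom_f K (p i / \<alpha>))) \<ge> 1 \<longleftrightarrow>
      (\<exists>l\<in>{1..K}. 1 \<le> (1 / of_nat l) * (\<Sum>i=1..l. hom_f K (p i / \<alpha>)))" for \<alpha>
    using assms by (subst Max_ge_iff) auto
  then show ?thesis by (simp add: F_EHom_def E_level_def)
qed

lemma E_level_subset: "E_level K p \<subseteq> {0<..<1}"
  by (auto simp: E_level_def)

lemma E_level_antimono:
  assumes "\<And>i. i \<in> {1..K} \<Longrightarrow> p i \<le> q i"
  shows "E_level K q \<subseteq> E_level K p"
proof
  fix \<alpha> assume "\<alpha> \<in> E_level K q"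
  then obtain l where l: "\<alpha> \<in> {0<..<1}" "l \<in> {1..K}"
      "1 \<le> (1 / of_nat l) * (\<Sum>i=1..l. hom_f K (q i / \<alpha>))"
    by (auto simp: E_level_def)
  have "(\<Sum>i=1..l. hom_f K (q i / \<alpha>)) \<le> (\<Sum>i=1..l. hom_f K (p i / \<alpha>))"
    using l assms by (intro sum_mono antimono_hom_f divide_right_mono) auto
  then have "1 \<le> (1 / of_nat l) * (\<Sum>i=1..l. hom_f K (p i / \<alpha>))"
    by (intro order_trans[OF l(3)] mult_left_mono) auto
  then show "\<alpha> \<in> E_level K p" using l by (auto simp: E_level_def)
qed

text \<open>For nonnegative \<open>p i\<close>, raising the level lowers
  \<open>p i / \<alpha>\<close> and so raises f. The levels therefore form an up-set in (0,1), so
  that testing a single level can replace computing the infimum.\<close>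

lemma E_level_upward:
  assumes "\<alpha> \<in> E_level K p" "\<alpha> \<le> \<beta>" "\<beta> < 1" "\<And>i. i \<in> {1..K} \<Longrightarrow> 0 \<le> p i"
  shows "\<beta> \<in> E_level K p"
proof -
  obtain l where l: "\<alpha> \<in> {0<..<1}" "l \<in> {1..K}"
      "1 \<le> (1 / of_nat l) * (\<Sum>i=1..l. hom_f K (p i / \<alpha>))"
    using assms(1) by (auto simp: E_level_def)
  have "(\<Sum>i=1..l. hom_f K (p i / \<alpha>)) \<le> (\<Sum>i=1..l. hom_f K (p i / \<beta>))"
    using l assms by (intro sum_mono antimono_hom_f divide_left_mono) auto
  then have "1 \<le> (1 / of_nat l) * (\<Sum>i=1..l. hom_f K (p i / \<beta>))"
    by (intro order_trans[OF l(3)] mult_left_mono) auto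
  then show ?thesis using l assms by (auto simp: E_level_def)
qed

lemma space_cube_nonneg: "p \<in> space (cube K) \<Longrightarrow> i \<in> {1..K} \<Longrightarrow> 0 \<le> p i"
  by (auto simp: space_cube PiE_iff)

text \<open>The strict inequality avoids the question whether the infimum is attained: some level
  lies strictly below \<beta>, and upward closure carries it to \<beta>.\<close>

lemma F_EHom_less_imp_E_level:
  assumes "K \<ge> 1" "p \<in> space (cube K)" "F_EHom K p < \<beta>" "\<beta> < 1"
  shows "\<beta> \<in> E_level K p"
proof -
  obtain \<alpha> where "\<alpha> \<in> E_level K p" "\<alpha> < \<beta>"
    using assms inf1_less_iff[OF E_level_subset, of \<beta> K p] by (auto simp: F_EHom_eq_inf1)
  then show ?thesis
    using E_level_upward[of \<alpha> K p \<beta>] space_cube_nonneg[OF assms(2)] assms(4) by simp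
qed

lemma measurable_E_level[measurable]: "{p\<in>space (cube K). \<beta> \<in> E_level K p} \<in> sets (cube K)"
proof -
  have [measurable]: "(\<lambda>x. hom_f K (x / \<beta>)) \<in> borel_measurable (restrict_space borel {0..1})"
    by (intro measurable_restrict_space1) measurable
  have "(\<lambda>p. hom_f K (p i / \<beta>)) \<in> borel_measurable (cube K)" if "i \<in> {1..K}" for i
    unfolding cube_def using that by measurable
  then have avg: "(\<lambda>p. (1 / of_nat l) * (\<Sum>i=1..l. hom_f K (p i / \<beta>))) \<in> borel_measurable (cube K)"
    if "l \<in> {1..K}" for l
    using that by (auto intro!: borel_measurable_times borel_measurable_sum)
  have "{p\<in>space (cube K). \<beta> \<in> E_level K p} = (if \<beta> \<in> {0<..<1} then
      (\<Union>l\<in>{1..K}. {p\<in>space (cube K). 1 \<le> (1 / of_nat l) * (\<Sum>i=1..l. hom_f K (p i / \<beta>))}) else {})"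
    unfolding E_level_def by auto
  also have "\<dots> \<in> sets (cube K)"
    using borel_measurable_le[OF borel_measurable_const avg] by auto
  finally show ?thesis .
qed

text \<open>Upward closure allows rational levels to suffice, so each strict sublevel set is a
  countable union of measurable sets.\<close>

lemma measurable_F_EHom:
  assumes "K \<ge> 1"
  shows "F_EHom K \<in> borel_measurable (cube K)"
  unfolding borel_measurable_iff_less
proof
  fix a :: real
  show "{p \<in> space (cube K). F_EHom K p < a} \<in> sets (cube K)"
  proof (cases "a > 1")
    case True
    have "F_EHom K p < a" for p
      using inf1_in_unit_interval[OF E_level_subset, of K p] True assms
      by (simp add: F_EHom_eq_inf1)
    then show ?thesis by simp
  next
    case False
    have "F_EHom K p < a \<longleftrightarrow> (\<exists>r::rat. of_rat r < a \<and> of_rat r \<in> E_level K p)"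
      if p: "p \<in> space (cube K)" for p
    proof
      assume "F_EHom K p < a"
      \<comment> \<open>A rational strictly between the infimum and \<open>a\<close> is below 1,
        since here \<open>a \<le> 1\<close>, and is thus itself a level.\<close>
      then obtain r :: rat where r: "F_EHom K p < of_rat r" "of_rat r < a"
        using of_rat_dense by blast
      then show "\<exists>r::rat. of_rat r < a \<and> of_rat r \<in> E_level K p"
        using F_EHom_less_imp_E_level[OF assms p r(1)] False by (metis linorder_not_less order.strict_trans2)
    next
      assume "\<exists>r::rat. of_rat r < a \<and> of_rat r \<in> E_level K p"
      then show "F_EHom K p < a"
        using inf1_less_iff[OF E_level_subset, of a K p] False assms
        by (auto simp: F_EHom_eq_inf1)
    qed
    then have "{p \<in> space (cube K). F_EHom K p < a} =
        (\<Union>r::rat. if of_rat r < a then {p\<in>space (cube K). of_rat r \<in> E_level K p} else {})"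
      by (auto split: if_splits)
    also have "\<dots> \<in> sets (cube K)"
      by (intro sets.countable_UN) auto
    finally show ?thesis .
  qed
qed

section \<open>Validity for exchangeable vectors\<close>

lemma E_level_prob_le:
  assumes M: "prob_space M" and K: "K \<ge> 1"
    and P: "P \<in> uniform_vectors M K" and ex: "exchangeable M K P"
    and \<beta>: "\<beta> \<in> {0<..<1}"
  shows "measure M {\<omega>\<in>space M. \<beta> \<in> E_level K (P \<omega>)} \<le> \<beta>"
proof -
  interpret prob_space M by fact
  \<comment> \<open>Passing to the law of \<open>P\<close> turns exchangeability into invariance of
    a measure under coordinate permutations, as \<open>exchangeable_markov\<close> requires.\<close>
  define N where "N = distr M (cube K) P"
  have P_meas[measurable]: "P \<in> M \<rightarrow>\<^sub>M cube K"
    using P by (simp add: uniform_vectors_def)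
  have P1: "distr M borel (\<lambda>\<omega>. P \<omega> 1) = uniform_measure lborel {0..1}"
    using P K by (simp add: uniform_vectors_def)
  have f_meas: "(\<lambda>x. hom_f K (x / \<beta>)) \<in> borel_measurable (restrict_space borel {0..1})"
    by (intro measurable_restrict_space1) measurable
  have perm_meas: "(\<lambda>x. \<lambda>i\<in>{1..K}. x (\<pi> i)) \<in> cube K \<rightarrow>\<^sub>M cube K" if "\<pi> permutes {1..K}" for \<pi>
    unfolding cube_def
  proof (rule measurable_restrict)
    fix k assume "k \<in> {1..K}"
    then have "\<pi> k \<in> {1..K}" using that permutes_in_image by metis
    then show "(\<lambda>x. x (\<pi> k)) \<in> (\<Pi>\<^sub>M i\<in>{1..K}. restrict_space borel {0..1}) \<rightarrow>\<^sub>M restrict_space borel {0..1}"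
      by (rule measurable_component_singleton)
  qed
  have coord1: "(\<lambda>x. x 1) \<in> cube K \<rightarrow>\<^sub>M (borel :: real measure)"
  proof -
    have "(\<lambda>x. x 1) \<in> cube K \<rightarrow>\<^sub>M restrict_space (borel :: real measure) {0..1}"
      unfolding cube_def using K by (intro measurable_component_singleton) auto
    then show ?thesis by (simp add: measurable_restrict_space2_iff)
  qed
  have "emeasure M {\<omega>\<in>space M. \<beta> \<in> E_level K (P \<omega>)}
      = emeasure N {p\<in>space (cube K). \<beta> \<in> E_level K p}"
    unfolding N_def using measurable_space[OF P_meas]
    by (subst emeasure_distr) (auto intro!: arg_cong[where f = "emeasure M"])
  also have "\<dots> = emeasure N {x\<in>space N. \<exists>l\<in>{1..K}.
      1 \<le> (1 / of_nat l) * (\<Sum>i=1..l. hom_f K (x i / \<beta>))}"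
    using \<beta> by (simp add: E_level_def N_def)
  also have "\<dots> \<le> (\<integral>\<^sup>+x. hom_f K (x 1 / \<beta>) \<partial>N)"
  proof (rule exchangeable_markov[where f = "\<lambda>x. hom_f K (x / \<beta>)", OF _ _ f_meas])
    show "sets N = sets (\<Pi>\<^sub>M i\<in>{1..K}. restrict_space borel {0..1})"
      by (simp add: N_def cube_def)
  next
    fix \<pi> :: "nat \<Rightarrow> nat" assume \<pi>: "\<pi> permutes {1..K}"
    have "distr N N (\<lambda>x. \<lambda>i\<in>{1..K}. x (\<pi> i)) = distr N (cube K) (\<lambda>x. \<lambda>i\<in>{1..K}. x (\<pi> i))"
      by (rule distr_cong) (auto simp: N_def)
    also have "\<dots> = distr M (cube K) (\<lambda>\<omega>. \<lambda>i\<in>{1..K}. P \<omega> (\<pi> i))"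
      unfolding N_def by (subst distr_distr[OF perm_meas[OF \<pi>] P_meas]) (simp add: o_def)
    also have "\<dots> = N"
      using ex \<pi> by (simp add: exchangeable_def N_def)
    finally show "distr N N (\<lambda>x. \<lambda>i\<in>{1..K}. x (\<pi> i)) = N" .
  qed
  \<comment> \<open>Only the first coordinate occurs, so the integral reduces to its marginal law,
    which is uniform.\<close>
  also have "\<dots> = (\<integral>\<^sup>+x. hom_f K (x / \<beta>) \<partial>(distr N borel (\<lambda>x. x 1)))"
    using coord1 by (subst nn_integral_distr) (auto simp: N_def)
  also have "distr N borel (\<lambda>x. x 1) = uniform_measure lborel {0..1}"
    unfolding N_def by (subst distr_distr[OF coord1 P_meas]) (simp add: o_def P1[simplified])
  also have "(\<integral>\<^sup>+x. hom_f K (x / \<beta>) \<partial>(uniform_measure lborel {0..1})) \<le> ennreal \<beta>"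
    using \<beta> by (intro nn_integral_hom_f_uniform) auto
  finally show ?thesis
    using \<beta> by (simp add: emeasure_eq_measure)
qed

lemma ex_p_merging_F_EHom:
  assumes M: "prob_space M" and K: "K \<ge> 1"
  shows "ex_p_merging M K (F_EHom K)"
  unfolding ex_p_merging_def
proof (intro conjI ballI impI)
  show "F_EHom K \<in> borel_measurable (cube K)" by (rule measurable_F_EHom[OF K])
next
  show "F_EHom K \<in> space (cube K) \<rightarrow> {0..1}"
    using inf1_in_unit_interval[OF E_level_subset] K by (simp add: F_EHom_eq_inf1)
next
  fix p q :: "nat \<Rightarrow> real" assume "\<forall>i\<in>{1..K}. p i \<le> q i"
  then show "F_EHom K p \<le> F_EHom K q"
    using inf1_antimono[OF E_level_antimono E_level_subset, of K p q] K
    by (simp add: F_EHom_eq_inf1)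
next
  fix P \<alpha> assume P: "P \<in> uniform_vectors M K" "exchangeable M K P" and \<alpha>: "\<alpha> \<in> {0<..<1::real}"
  interpret prob_space M by fact
  have P_meas[measurable]: "P \<in> M \<rightarrow>\<^sub>M cube K"
    using P by (simp add: uniform_vectors_def)
  show "measure M {\<omega>\<in>space M. F_EHom K (P \<omega>) \<le> \<alpha>} \<le> \<alpha>"
  \<comment> \<open>If the infimum is at most \<alpha>, every \<beta> in (\<alpha>, 1) is a level.
    Bounding the probability by each such \<beta> bounds it by \<alpha>.\<close>
  proof (rule dense_ge_bounded[where x = 1])
    show "\<alpha> < 1" using \<alpha> by simp
  next
    fix \<beta> assume \<beta>: "\<alpha> < \<beta>" "\<beta> < 1"
    \<comment> \<open>Monotonicity of \<open>measure\<close> needs this larger event to be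
      measurable.\<close>
    have "{\<omega>\<in>space M. \<beta> \<in> E_level K (P \<omega>)} = P -` {p\<in>space (cube K). \<beta> \<in> E_level K p} \<inter> space M"
      using measurable_space[OF P_meas] by auto
    also have "\<dots> \<in> sets M" by measurable
    finally have "measure M {\<omega>\<in>space M. F_EHom K (P \<omega>) \<le> \<alpha>}
        \<le> measure M {\<omega>\<in>space M. \<beta> \<in> E_level K (P \<omega>)}"
      using F_EHom_less_imp_E_level[OF K measurable_space[OF P_meas]] \<beta>
      by (intro finite_measure_mono) auto
    also have "\<dots> \<le> \<beta>" using E_level_prob_le[OF M K P] \<alpha> \<beta> by auto
    finally show "measure M {\<omega>\<in>space M. F_EHom K (P \<omega>) \<le> \<alpha>} \<le> \<beta>" .
  qed
qed

section \<open>Strict domination of \<open>F_Hom\<close>\<close>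

lemma F_EHom_le_F_Hom:
  assumes "K \<ge> 1"
  shows "F_EHom K p \<le> F_Hom K p"
  unfolding F_EHom_eq_inf1[OF assms] F_Hom_def
  \<comment> \<open>The condition in \<open>F_Hom\<close> is the case \<open>l = K\<close>, so its
    levels are among those of \<open>F_EHom\<close>.\<close>
  by (rule inf1_antimono) (use assms in \<open>auto simp: E_level_def\<close>)

text \<open>With one small value in first position, the running average of length 1 already crosses
  the threshold, while the full average is diluted by zeros.\<close>

lemma exists_F_EHom_less_F_Hom:
  assumes "K \<ge> 2"
  shows "\<exists>p\<in>space (cube K). F_EHom K p < F_Hom K p"
proof -
  have "harm 2 \<le> (harm K :: real)"
    using assms by (intro harm_mono)
  then have h: "harm K > (1::real)" by (simp add: harm_expand)
  define a where "a = 1 / (real K * harm K)"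
  have a: "0 < a" "a \<le> 1" using assms h mult_mono[of 1 "real K" 1 "harm K"]
    by (auto simp: a_def)
  define p where "p = (\<lambda>i\<in>{1..K}. if i = 1 then a else 1)"
  have p: "p \<in> space (cube K)" using a by (auto simp: space_cube p_def)
  have p1: "p 1 = a" using assms by (simp add: p_def)
  \<comment> \<open>At level 1/K the first coordinate is rescaled to 1/h_K, the right end of the
    support, where f equals K/K.\<close>
  have "hom_f K (a / (1 / real K)) = 1"
    using assms h by (simp add: hom_f_def a_def)
  \<comment> \<open>The witness is \<open>l = 1\<close>; \<open>K \<ge> 2\<close> places 1/K in the
    open interval.\<close>
  then have mem: "1 / real K \<in> E_level K p"
    using assms by (auto simp: E_level_def p1[simplified] intro!: bexI[of _ 1])
  then have "Inf (E_level K p) \<le> 1 / real K"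
    using E_level_subset[of K p] by (intro cInf_lower bdd_belowI[of _ 0]) auto
  then have "F_EHom K p < 1"
    using mem assms by (auto simp: F_EHom_eq_inf1 inf1_def order.strict_trans1)
  moreover have "F_Hom K p = 1"
  proof -
    have "\<not> 1 \<le> (1 / of_nat K) * (\<Sum>k=1..K. hom_f K (p k / \<alpha>))" if \<alpha>: "\<alpha> \<in> {0<..<1}" for \<alpha>
    proof -
      have "hom_f K (p k / \<alpha>) = 0" if "k \<in> {2..K}" for k
      proof -
        \<comment> \<open>The coordinates equal to 1 are rescaled to 1/\<alpha>, beyond the support
          of f.\<close>
        have "harm K / \<alpha> > 1" using \<alpha> h by (simp add: field_simps)
        then show ?thesis using that \<alpha> by (auto simp: hom_f_def p_def)
      qed
      then have "(\<Sum>k=2..K. hom_f K (p k / \<alpha>)) = 0" by simp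
      moreover have "{1..K} = insert 1 {2..K}" using assms by auto
      ultimately have s: "(\<Sum>k=1..K. hom_f K (p k / \<alpha>)) = hom_f K (a / \<alpha>)"
        by (simp add: p1[simplified])
      have "real K * harm K * (a / \<alpha>) = 1 / \<alpha>"
        using assms h by (simp add: a_def)
      \<comment> \<open>Since \<alpha> < 1 strictly, the ceiling is at least 2. Hence f is at most
        K/2 and the full average at most 1/2.\<close>
      moreover have "1 / \<alpha> > 1" using \<alpha> by simp
      then have "\<lceil>1 / \<alpha>\<rceil> \<ge> 2" by linarith
      then have c: "real_of_int \<lceil>1 / \<alpha>\<rceil> \<ge> 2" by linarith
      ultimately have "hom_f K (a / \<alpha>) = ennreal (real K * indicator {q. harm K * q \<le> 1} (a / \<alpha>) / real_of_int \<lceil>1 / \<alpha>\<rceil>)"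
        using a \<alpha> by (simp add: hom_f_def)
      also have "\<dots> \<le> ennreal (real K / 2)"
        using c by (intro ennreal_leI frac_le) (auto simp: indicator_def)
      finally have "(1 / of_nat K) * hom_f K (a / \<alpha>) \<le> (1 / of_nat K) * ennreal (real K / 2)"
        by (rule mult_left_mono) simp
      also have "\<dots> = ennreal (1 / 2)"
      proof -
        have "(1 / of_nat K :: ennreal) = ennreal (1 / real K)"
          using assms divide_ennreal[of 1 "real K"] by (simp add: ennreal_of_nat_eq_real_of_nat)
        then show ?thesis using assms by (simp add: ennreal_mult[symmetric])
      qed
      also have "\<dots> < 1" by (subst ennreal_1[symmetric], subst ennreal_less_iff) auto
      finally show ?thesis unfolding s by (simp only: not_le)
    qed
    \<comment> \<open>No level qualifies, so \<open>F_Hom\<close> takes its default value 1.\<close>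
    then have "{\<alpha>\<in>{0<..<1}. (1 / of_nat K) * (\<Sum>k=1..K. hom_f K (p k / \<alpha>)) \<ge> 1} = {}"
      by auto
    then show ?thesis unfolding F_Hom_def by (simp only: inf1_def simp_thms if_True)
  qed
  ultimately show ?thesis using p by (intro bexI[of _ p]) simp_all
qed

theorem theorem5p2:
  fixes M :: "'a measure" and K :: nat
  assumes "prob_space M" and "atomless M" and "K \<ge> 2"
  shows "ex_p_merging M K (F_EHom K) \<and> strictly_dominates K (F_EHom K) (F_Hom K)"
  using assms ex_p_merging_F_EHom[of M K] F_EHom_le_F_Hom[of K] exists_F_EHom_less_F_Hom[of K]
  by (simp add: strictly_dominates_def)

end
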